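(* For every positive integer $n$: $\binom{12n}{3n}\equiv\binom{12n}{4n}\equiv 0 \pmod{6n-1}$; $\binom{30n}{5n}\equiv 0\pmod{(10n-1)(15n-1)}$; $\binom{60n}{6n}\equiv\binom{120n}{40n}\equiv\binom{120n}{45n}\equiv 0\pmod{30n-1}$; $\binom{330n}{88n}\equiv 0\pmod{66n-1}$. *)

theory Defs
  imports "HOL-Number_Theory.Cong"
begin

end

theory Submission
  imports Defs
begin

text \<open>
  By Kummer's theorem, \<open>m\<close> divides \<open>N choose k\<close> as soon as \<open>N mod d < k mod d\<close> for every divisor
  \<open>d > 1\<close> of \<open>m\<close>: each prime power \<open>p ^ j\<close> dividing \<open>m\<close> then contributes a carry in base \<open>p\<close>.
  In all cases of the theorem \<open>m = a n - 1\<close>, \<open>N = b n\<close> and \<open>k = e n\<close>, where \<open>a\<close> divides \<open>b\<close> but not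
  \<open>e\<close>. Writing \<open>b = c a\<close> and \<open>e / a = s / r\<close> in lowest terms, we have \<open>N \<equiv> c\<close> and \<open>r k \<equiv> s\<close>
  modulo \<open>d\<close>. If \<open>d > r c = b / gcd a e\<close>, then the residue of \<open>k\<close> exceeds \<open>c\<close>, for otherwise the congruence
  would be an equality and \<open>r\<close> would divide \<open>s\<close>. The finitely many smaller \<open>d\<close> are checked
  individually, for every possible residue \<open>t\<close> of \<open>n\<close>.
\<close>

lemma multiplicity_eq_card_power_dvd:
  fixes p n L :: nat
  assumes "p > 1" and "0 < n" and "n < p ^ Suc L"
  shows "multiplicity p n = card {j \<in> {1..L}. p ^ j dvd n}"
proof -
  have dvd_iff: "p ^ j dvd n \<longleftrightarrow> j \<le> multiplicity p n" for j
    using assms by (intro power_dvd_iff_le_multiplicity) auto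
  have "p ^ multiplicity p n < p ^ Suc L"
    using assms multiplicity_dvd[of p n] dvd_imp_le le_less_trans by blast
  then have "multiplicity p n \<le> L"
    using assms(1) by (simp only: power_strict_increasing_iff less_Suc_eq_le)
  then have "{j \<in> {1..L}. p ^ j dvd n} = {1..multiplicity p n}"
    unfolding dvd_iff by auto
  then show ?thesis by simp
qed

theorem legendre_multiplicity_fact:
  fixes p n L :: nat
  assumes "prime p" and "n < p ^ Suc L"
  shows "multiplicity p (fact n :: nat) = (\<Sum>j=1..L. n div p ^ j)"
  using assms(2)
proof (induction n)
  case 0
  then show ?case by simp
next
  case (Suc n)
  have "multiplicity p (fact (Suc n) :: nat) = multiplicity p (Suc n) + multiplicity p (fact n :: nat)"
    unfolding fact_Suc using assms(1)
    by (simp add: prime_elem_multiplicity_mult_distrib del: mult_Suc)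
  also have "multiplicity p (Suc n) = (\<Sum>j=1..L. of_bool (p ^ j dvd Suc n))"
    using multiplicity_eq_card_power_dvd[OF prime_gt_1_nat[OF assms(1)] _ Suc.prems]
    by (simp add: Int_def)
  also have "multiplicity p (fact n :: nat) = (\<Sum>j=1..L. n div p ^ j)"
    using Suc by simp
  also have "(\<Sum>j=1..L. of_bool (p ^ j dvd Suc n)) + (\<Sum>j=1..L. n div p ^ j)
      = (\<Sum>j=1..L. Suc n div p ^ j)"
    unfolding sum.distrib[symmetric] by (intro sum.cong) (auto simp: div_Suc dvd_eq_mod_eq_0)
  finally show ?case .
qed

lemma div_eq_div_add_div_diff:
  fixes N k d :: nat
  assumes "k \<le> N" and "d > 0"
  shows "N div d = k div d + (N - k) div d + of_bool (N mod d < k mod d)"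
proof -
  define x where "x = k mod d"
  define y where "y = (N - k) mod d"
  have less: "x < d" "y < d" using assms(2) by (simp_all add: x_def y_def)
  have "N div d = k div d + (N - k) div d + (x + y) div d"
    using div_add1_eq[of k "N - k" d] assms(1) by (simp add: x_def y_def)
  moreover have "N mod d = (x + y) mod d"
    using assms(1) by (simp add: x_def y_def mod_add_eq)
  moreover have "(x + y) div d = of_bool ((x + y) mod d < x)"
  proof (cases "x + y < d")
    case False
    then have "(x + y) div d = 1" and "(x + y) mod d = x + y - d"
      using less by (simp_all add: div_if mod_if)
    then show ?thesis using less False by simp
  qed simp
  ultimately show ?thesis by (simp add: x_def)
qed

text \<open>The digits of \<open>N\<close> below position \<open>j\<close> form a smaller number than those of \<open>k\<close>
  exactly if adding \<open>k\<close> and \<open>N - k\<close> in base \<open>p\<close> carries into position \<open>j\<close>.\<close>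

definition carry_positions :: "nat \<Rightarrow> nat \<Rightarrow> nat \<Rightarrow> nat set" where
  "carry_positions p N k = {j. N mod p ^ j < k mod p ^ j}"

lemma carry_positions_subset:
  assumes "p > 1" and "k \<le> N"
  shows "carry_positions p N k \<subseteq> {1..N}"
proof
  fix j assume "j \<in> carry_positions p N k"
  then have carry: "N mod p ^ j < k mod p ^ j" by (simp add: carry_positions_def)
  then have "j \<noteq> 0" by (intro notI) simp
  moreover have "p ^ j \<le> N"
  proof (rule ccontr)
    assume "\<not> p ^ j \<le> N"
    then show False using carry assms(2) by simp
  qed
  then have "j \<le> N" using power_gt_expt[of p j] assms(1) by simp
  ultimately show "j \<in> {1..N}" by simp
qed

theorem kummer_multiplicity_binomial:
  fixes p N k :: nat
  assumes "prime p" and "k \<le> N"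
  shows "multiplicity p (N choose k) = card (carry_positions p N k)"
proof -
  let ?S = "\<lambda>n. \<Sum>j=1..N. n div p ^ j"
  have p_gt_1: "p > 1" using assms(1) by (rule prime_gt_1_nat)
  have legendre: "multiplicity p (fact n :: nat) = ?S n" if "n \<le> N" for n
  proof (rule legendre_multiplicity_fact[OF assms(1)])
    show "n < p ^ Suc N" using that p_gt_1 power_gt_expt[of p "Suc N"] by linarith
  qed
  have "?S k + ?S (N - k) + multiplicity p (N choose k)
      = multiplicity p (fact k * fact (N - k) * (N choose k))"
    using assms by (simp add: legendre prime_elem_multiplicity_mult_distrib)
  also have "\<dots> = ?S N"
    using binomial_fact_lemma[OF assms(2)] by (simp add: legendre)
  also have "\<dots> = (\<Sum>j=1..N. k div p ^ j + (N - k) div p ^ j + of_bool (j \<in> carry_positions p N k))"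
    using p_gt_1 assms(2) by (intro sum.cong) (simp_all add: div_eq_div_add_div_diff carry_positions_def)
  also have "\<dots> = ?S k + ?S (N - k) + card ({1..N} \<inter> carry_positions p N k)"
    by (simp add: sum.distrib)
  also have "{1..N} \<inter> carry_positions p N k = carry_positions p N k"
    using carry_positions_subset[OF p_gt_1 assms(2)] by blast
  finally show ?thesis by simp
qed

lemma dvd_binomial_if_mod_less:
  fixes m N k :: nat
  assumes "m > 0" and mod_less: "\<And>d. d > 1 \<Longrightarrow> d dvd m \<Longrightarrow> N mod d < k mod d"
  shows "m dvd N choose k"
proof (cases "k \<le> N")
  case True
  show ?thesis
  proof (rule multiplicity_le_imp_dvd)
    show "m \<noteq> 0" using assms(1) by simp
    fix p :: nat assume p: "prime p"
    have "{1..multiplicity p m} \<subseteq> carry_positions p N k"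
    proof
      fix j assume "j \<in> {1..multiplicity p m}"
      then show "j \<in> carry_positions p N k"
        unfolding carry_positions_def using prime_gt_1_nat[OF p]
        by (intro CollectI mod_less one_less_power multiplicity_dvd') auto
    qed
    then have "card {1..multiplicity p m} \<le> card (carry_positions p N k)"
      using carry_positions_subset[OF prime_gt_1_nat[OF p] True] finite_subset
      by (intro card_mono) auto
    then show "multiplicity p m \<le> multiplicity p (N choose k)"
      using kummer_multiplicity_binomial[OF p True] by simp
  qed
qed (simp add: binomial_eq_0)

lemma mod_less_mod_if_cong:
  fixes N k d c r s :: nat
  assumes "[N = c] (mod d)" and "[r * k = s] (mod d)"
    and "s < d" and "r * c < d" and "\<not> r dvd s"
  shows "N mod d < k mod d"
proof (rule ccontr)
  assume "\<not> N mod d < k mod d"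
  then have "k mod d \<le> c mod d"
    using assms(1) by (simp add: cong_def)
  then have "k mod d \<le> c"
    using mod_less_eq_dividend[of c d] by linarith
  then have "r * (k mod d) < d"
    using assms(4) by (meson le_less_trans mult_le_mono2)
  then have "r * (k mod d) = s"
    using assms(2,3) by (metis cong_def mod_less mod_mult_right_eq)
  then show False using assms(5) by auto
qed

lemma mod_less_mod_if_not_dvd:
  fixes a b d e n :: nat
  assumes cong: "[a * n = 1] (mod d)" and "a dvd b" and "\<not> a dvd e" and "e \<le> b"
    and large: "b div gcd a e < d"
  shows "(b * n) mod d < (e * n) mod d"
proof -
  define g where "g = gcd a e"
  have "g > 0" using assms(3) by (auto simp: g_def intro!: Nat.gr0I)
  then obtain r s where a_eq: "a = r * g" and e_eq: "e = s * g"
    using gcd_coprime_exists[of a e, folded g_def] by blast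
  obtain c where b_eq: "b = a * c" using assms(2) by blast
  have rc_eq: "r * c = b div g" using \<open>g > 0\<close> by (simp add: a_eq b_eq)
  show ?thesis
  proof (rule mod_less_mod_if_cong)
    show "[b * n = c] (mod d)"
      using cong_scalar_left[OF cong, of c] by (simp add: b_eq ac_simps)
    show "[r * (e * n) = s] (mod d)"
      using cong_scalar_left[OF cong, of s] by (simp add: a_eq e_eq ac_simps)
    show "r * c < d" using large by (simp add: rc_eq g_def)
    have "s \<le> r * c" using assms(4) \<open>g > 0\<close> by (simp add: a_eq b_eq e_eq ac_simps)
    with \<open>r * c < d\<close> show "s < d" by simp
    show "\<not> r dvd s" using assms(3) by (auto simp: a_eq e_eq)
  qed
qed

theorem pred_dvd_binomial:
  fixes a b e n :: nat
  assumes "n > 0" and "a dvd b" and "\<not> a dvd e"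
    and small: "\<forall>d\<in>{2..b div gcd a e}. \<forall>t\<in>{..<d}. [a * t = 1] (mod d) \<longrightarrow> b * t mod d < e * t mod d"
  shows "a * n - 1 dvd (b * n) choose (e * n)"
proof (cases "e \<le> b")
  case e_le_b: True
  have "a \<noteq> 0" using assms(2,3) e_le_b by (metis dvd_0_left_iff le_zero_eq)
  moreover have "a \<noteq> 1" using assms(3) by auto
  ultimately have "2 * 1 \<le> a * n" using assms(1) by (intro mult_le_mono) auto
  then have "a * n > 1" by simp
  show ?thesis
  proof (rule dvd_binomial_if_mod_less)
    show "a * n - 1 > 0" using \<open>a * n > 1\<close> by simp
    fix d :: nat assume d: "d > 1" "d dvd a * n - 1"
    then have cong: "[a * n = 1] (mod d)"
      using \<open>a * n > 1\<close> cong_altdef_nat[of 1 "a * n" d] less_imp_le by blast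
    show "(b * n) mod d < (e * n) mod d"
    proof (cases "d \<le> b div gcd a e")
      case True
      have "[a * (n mod d) = 1] (mod d)" using cong by (simp add: cong_def mod_mult_right_eq)
      moreover have "d \<in> {2..b div gcd a e}" and "n mod d \<in> {..<d}" using True d(1) by simp_all
      ultimately have "b * (n mod d) mod d < e * (n mod d) mod d" using small by blast
      then show ?thesis by (simp add: mod_mult_right_eq)
    next
      case False
      then show ?thesis using mod_less_mod_if_not_dvd[OF cong assms(2,3) e_le_b] by simp
    qed
  qed
next
  case False
  then show ?thesis using assms(1) by (simp add: binomial_eq_0)
qed

theorem theorem2p3:
  fixes n :: nat
  assumes "n > 0"
  shows "([(12 * n) choose (3 * n) = (12 * n) choose (4 * n)] (mod (6 * n - 1)) \<and>
          [(12 * n) choose (4 * n) = 0] (mod (6 * n - 1))) \<and>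
         [(30 * n) choose (5 * n) = 0] (mod ((10 * n - 1) * (15 * n - 1))) \<and>
         ([(60 * n) choose (6 * n) = (120 * n) choose (40 * n)] (mod (30 * n - 1)) \<and>
          [(120 * n) choose (40 * n) = (120 * n) choose (45 * n)] (mod (30 * n - 1)) \<and>
          [(120 * n) choose (45 * n) = 0] (mod (30 * n - 1))) \<and>
         [(330 * n) choose (88 * n) = 0] (mod (66 * n - 1))"
proof -
  note small_residues = gcd_non_0_nat cong_def atLeastAtMost_upt lessThan_nat_numeral lessThan_Suc
  have pred_dvd: "6 * n - 1 dvd (12 * n) choose (3 * n)" "6 * n - 1 dvd (12 * n) choose (4 * n)"
    "30 * n - 1 dvd (60 * n) choose (6 * n)" "30 * n - 1 dvd (120 * n) choose (40 * n)"
    "30 * n - 1 dvd (120 * n) choose (45 * n)" "66 * n - 1 dvd (330 * n) choose (88 * n)"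
    by (rule pred_dvd_binomial[OF assms]; simp add: small_residues)+
  have "10 * n - 1 dvd (30 * n) choose (5 * n)" "15 * n - 1 dvd (30 * n) choose (5 * n)"
    by (rule pred_dvd_binomial[OF assms]; simp add: small_residues)+
  moreover have "coprime (10 * n - 1) (15 * n - 1)"
  proof -
    have "2 * (15 * n - 1) = Suc (3 * (10 * n - 1))" using assms by simp
    then have "coprime (3 * (10 * n - 1)) (2 * (15 * n - 1))"
      by (simp only: coprime_Suc_right_nat)
    then show ?thesis by simp
  qed
  ultimately have "(10 * n - 1) * (15 * n - 1) dvd (30 * n) choose (5 * n)"
    by (rule divides_mult)
  with pred_dvd show ?thesis by (simp add: cong_def dvd_eq_mod_eq_0)
qed

end
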